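(* Let $\mathcal T$ be a triangulated category (in the sense of Puppe) with a chosen distinguished triangle $A\xrightarrow{f}B\xrightarrow{u_f}C_f\xrightarrow{v_f}A[1]$ for each morphism $f:A\to B$. Let $f:A\to B$ and $f':A'\to B'$ be morphisms of $\mathcal T$, and let $$\theta(f,f'):\Delta(f,f')\to\Theta(f,f')$$ be the homomorphism induced by $x\mapsto u_{f'}\circ x\circ v_f$ for $x:A[1]\to B'$, where $\Delta(f,f')$ is the quotient of $\mathrm{Hom}_{\mathcal T}(A[1],B')$ by the subgroup $\{f'\circ g-h\circ f[1]\mid g:A[1]\to A',\ h:B[1]\to B'\}$ and $\Theta(f,f')=\{c:C_f\to C_{f'}\mid cu_f=0,\ v_{f'}c=0\}$. If $f$ or $f'$ is splittable, then $\theta(f,f')$ is an isomorphism.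
   Context: A (Puppe) triangulated category is an additive category $\mathcal T$ with an autoequivalence $A\mapsto A[1]$ and a class of diagrams $X\to Y\to Z\to X[1]$ (distinguished triangles) such that: (TR1) the class is closed under isomorphism of such diagrams; (TR2) $X\xrightarrow{\mathrm{id}}X\to0\to X[1]$ is distinguished; (TR3) if $X\xrightarrow{f}Y\xrightarrow{g}Z\xrightarrow{h}X[1]$ is distinguished then so is $Y\xrightarrow{g}Z\xrightarrow{h}X[1]\xrightarrow{-f[1]}Y[1]$; (TR4) every $f:X\to Y$ is the first map of some distinguished triangle; (TR5) any commutative square between the first maps of two distinguished triangles extends to a morphism of triangles. The octahedral axiom is not assumed. A morphism $f:X\to Y$ of an additive category is splittable if there is a morphism $s:Y\to X$ with $fsf=f$. No assumption that idempotents split in $\mathcal T$ is made. *)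

theory Defs
  imports "HOL-Algebra.Coset"
begin

section \<open>Categories, functors, equivalences\<close>

record ('o, 'm) category =
  Ob :: "'o set"
  Hom :: "'o \<Rightarrow> 'o \<Rightarrow> 'm set"
  Id :: "'o \<Rightarrow> 'm"
  Comp :: "'m \<Rightarrow> 'm \<Rightarrow> 'm"  (infixl \<open>\<cdot>\<index>\<close> 70)

text \<open>
  Composition is written in applicative order. The hom-sets are pairwise disjoint, so a morphism
  determines its source and target and \<^const>\<open>Comp\<close> needs no object arguments. Nothing
  is assumed about \<^const>\<open>Hom\<close> outside \<^const>\<open>Ob\<close>.
\<close>

locale category =
  fixes C :: "('o, 'm, 'x) category_scheme" (structure)
  assumes Hom_disjoint:
      "\<lbrakk>A \<in> Ob C; B \<in> Ob C; A' \<in> Ob C; B' \<in> Ob C; f \<in> Hom C A B; f \<in> Hom C A' B'\<rbrakk>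
        \<Longrightarrow> A = A' \<and> B = B'"
    and Id_in_Hom: "A \<in> Ob C \<Longrightarrow> Id C A \<in> Hom C A A"
    and Comp_in_Hom:
      "\<lbrakk>A \<in> Ob C; B \<in> Ob C; D \<in> Ob C; f \<in> Hom C A B; g \<in> Hom C B D\<rbrakk> \<Longrightarrow> g \<cdot> f \<in> Hom C A D"
    and Comp_Id: "\<lbrakk>A \<in> Ob C; B \<in> Ob C; f \<in> Hom C A B\<rbrakk> \<Longrightarrow> f \<cdot> Id C A = f"
    and Id_Comp: "\<lbrakk>A \<in> Ob C; B \<in> Ob C; f \<in> Hom C A B\<rbrakk> \<Longrightarrow> Id C B \<cdot> f = f"
    and Comp_assoc:
      "\<lbrakk>A \<in> Ob C; B \<in> Ob C; D \<in> Ob C; E \<in> Ob C; f \<in> Hom C A B; g \<in> Hom C B D; h \<in> Hom C D E\<rbrakk>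
        \<Longrightarrow> (h \<cdot> g) \<cdot> f = h \<cdot> (g \<cdot> f)"

definition iso_arrow :: "('o, 'm, 'x) category_scheme \<Rightarrow> 'o \<Rightarrow> 'o \<Rightarrow> 'm \<Rightarrow> bool" where
  "iso_arrow C A B f \<longleftrightarrow> f \<in> Hom C A B \<and>
     (\<exists>g \<in> Hom C B A. g \<cdot>\<^bsub>C\<^esub> f = Id C A \<and> f \<cdot>\<^bsub>C\<^esub> g = Id C B)"

definition is_functor ::
  "('o, 'm, 'x) category_scheme \<Rightarrow> ('p, 'n, 'y) category_scheme \<Rightarrow> ('o \<Rightarrow> 'p) \<Rightarrow> ('m \<Rightarrow> 'n) \<Rightarrow> bool"
where
  "is_functor C D Fo Fm \<longleftrightarrow>
     (\<forall>A \<in> Ob C. Fo A \<in> Ob D) \<and>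
     (\<forall>A \<in> Ob C. \<forall>B \<in> Ob C. \<forall>f \<in> Hom C A B. Fm f \<in> Hom D (Fo A) (Fo B)) \<and>
     (\<forall>A \<in> Ob C. Fm (Id C A) = Id D (Fo A)) \<and>
     (\<forall>A \<in> Ob C. \<forall>B \<in> Ob C. \<forall>E \<in> Ob C. \<forall>f \<in> Hom C A B. \<forall>g \<in> Hom C B E.
        Fm (g \<cdot>\<^bsub>C\<^esub> f) = Fm g \<cdot>\<^bsub>D\<^esub> Fm f)"

definition natural_iso ::
  "('o, 'm, 'x) category_scheme \<Rightarrow> ('p, 'n, 'y) category_scheme \<Rightarrow> ('o \<Rightarrow> 'p) \<Rightarrow> ('m \<Rightarrow> 'n) \<Rightarrow>
   ('o \<Rightarrow> 'p) \<Rightarrow> ('m \<Rightarrow> 'n) \<Rightarrow> ('o \<Rightarrow> 'n) \<Rightarrow> bool"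
where
  "natural_iso C D Fo Fm Go Gm \<eta> \<longleftrightarrow>
     (\<forall>A \<in> Ob C. iso_arrow D (Fo A) (Go A) (\<eta> A)) \<and>
     (\<forall>A \<in> Ob C. \<forall>B \<in> Ob C. \<forall>f \<in> Hom C A B. \<eta> B \<cdot>\<^bsub>D\<^esub> Fm f = Gm f \<cdot>\<^bsub>D\<^esub> \<eta> A)"

definition autoequivalence ::
  "('o, 'm, 'x) category_scheme \<Rightarrow> ('o \<Rightarrow> 'o) \<Rightarrow> ('m \<Rightarrow> 'm) \<Rightarrow> bool"
where
  "autoequivalence C Fo Fm \<longleftrightarrow> is_functor C C Fo Fm \<and>
     (\<exists>Go Gm \<eta> \<epsilon>. is_functor C C Go Gm \<and>
        natural_iso C C id id (Go \<circ> Fo) (Gm \<circ> Fm) \<eta> \<and>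
        natural_iso C C (Fo \<circ> Go) (Fm \<circ> Gm) id id \<epsilon>)"


section \<open>Additive categories\<close>

record ('o, 'm) additive_category = "('o, 'm) category" +
  Add :: "'m \<Rightarrow> 'm \<Rightarrow> 'm"  (infixl \<open>\<^bold>+\<index>\<close> 65)
  Zero :: "'o \<Rightarrow> 'o \<Rightarrow> 'm"

text \<open>
  The abelian group of morphisms, in the multiplicative notation of HOL-Algebra.
\<close>

definition hom_group :: "('o, 'm, 'x) additive_category_scheme \<Rightarrow> 'o \<Rightarrow> 'o \<Rightarrow> 'm monoid" where
  "hom_group C A B = \<lparr>carrier = Hom C A B, mult = Add C, one = Zero C A B\<rparr>"

abbreviation Neg :: "('o, 'm, 'x) additive_category_scheme \<Rightarrow> 'o \<Rightarrow> 'o \<Rightarrow> 'm \<Rightarrow> 'm" where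
  "Neg C A B f \<equiv> inv\<^bsub>hom_group C A B\<^esub> f"

definition zero_object :: "('o, 'm, 'x) category_scheme \<Rightarrow> 'o \<Rightarrow> bool" where
  "zero_object C Z \<longleftrightarrow> Z \<in> Ob C \<and>
     (\<forall>X \<in> Ob C. (\<exists>!f. f \<in> Hom C X Z) \<and> (\<exists>!f. f \<in> Hom C Z X))"

definition biproduct ::
  "('o, 'm, 'x) additive_category_scheme \<Rightarrow> 'o \<Rightarrow> 'o \<Rightarrow> 'o \<Rightarrow> 'm \<Rightarrow> 'm \<Rightarrow> 'm \<Rightarrow> 'm \<Rightarrow> bool"
where
  "biproduct C A B P i j p q \<longleftrightarrow> P \<in> Ob C \<and>
     i \<in> Hom C A P \<and> j \<in> Hom C B P \<and> p \<in> Hom C P A \<and> q \<in> Hom C P B \<and>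
     p \<cdot>\<^bsub>C\<^esub> i = Id C A \<and> q \<cdot>\<^bsub>C\<^esub> j = Id C B \<and>
     p \<cdot>\<^bsub>C\<^esub> j = Zero C B A \<and> q \<cdot>\<^bsub>C\<^esub> i = Zero C A B \<and>
     i \<cdot>\<^bsub>C\<^esub> p \<^bold>+\<^bsub>C\<^esub> j \<cdot>\<^bsub>C\<^esub> q = Id C P"

locale additive_category = category C
  for C :: "('o, 'm, 'x) additive_category_scheme" (structure) +
  assumes hom_comm_group: "\<lbrakk>A \<in> Ob C; B \<in> Ob C\<rbrakk> \<Longrightarrow> comm_group (hom_group C A B)"
    and Comp_Add_left:
      "\<lbrakk>A \<in> Ob C; B \<in> Ob C; D \<in> Ob C; f \<in> Hom C A B; g \<in> Hom C B D; h \<in> Hom C B D\<rbrakk>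
        \<Longrightarrow> (g \<^bold>+ h) \<cdot> f = g \<cdot> f \<^bold>+ h \<cdot> f"
    and Comp_Add_right:
      "\<lbrakk>A \<in> Ob C; B \<in> Ob C; D \<in> Ob C; f \<in> Hom C A B; g \<in> Hom C A B; h \<in> Hom C B D\<rbrakk>
        \<Longrightarrow> h \<cdot> (f \<^bold>+ g) = h \<cdot> f \<^bold>+ h \<cdot> g"
    and zero_object_exists: "\<exists>Z. zero_object C Z"
    and biproduct_exists:
      "\<lbrakk>A \<in> Ob C; B \<in> Ob C\<rbrakk> \<Longrightarrow> \<exists>P i j p q. biproduct C A B P i j p q"

definition splittable :: "('o, 'm, 'x) category_scheme \<Rightarrow> 'o \<Rightarrow> 'o \<Rightarrow> 'm \<Rightarrow> bool" where
  "splittable C X Y f \<longleftrightarrow> f \<in> Hom C X Y \<and> (\<exists>s \<in> Hom C Y X. f \<cdot>\<^bsub>C\<^esub> s \<cdot>\<^bsub>C\<^esub> f = f)"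


section \<open>Puppe triangulated categories\<close>

text \<open>
  \<open>Dist T X Y Z f g h\<close> says that \<open>f : X \<rightarrow> Y\<close>, \<open>g : Y \<rightarrow> Z\<close>, \<open>h : Z \<rightarrow> X[1]\<close> form a
  distinguished triangle.
\<close>

record ('o, 'm) triangulated_category = "('o, 'm) additive_category" +
  Shift_ob :: "'o \<Rightarrow> 'o"  (\<open>\<Sigma>\<^sub>o\<index>\<close>)
  Shift :: "'m \<Rightarrow> 'm"  (\<open>\<Sigma>\<index>\<close>)
  Dist :: "'o \<Rightarrow> 'o \<Rightarrow> 'o \<Rightarrow> 'm \<Rightarrow> 'm \<Rightarrow> 'm \<Rightarrow> bool"

definition is_triangle ::
  "('o, 'm, 'x) triangulated_category_scheme \<Rightarrow> 'o \<Rightarrow> 'o \<Rightarrow> 'o \<Rightarrow> 'm \<Rightarrow> 'm \<Rightarrow> 'm \<Rightarrow> bool"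
where
  "is_triangle T X Y Z f g h \<longleftrightarrow> X \<in> Ob T \<and> Y \<in> Ob T \<and> Z \<in> Ob T \<and>
     f \<in> Hom T X Y \<and> g \<in> Hom T Y Z \<and> h \<in> Hom T Z (\<Sigma>\<^sub>o\<^bsub>T\<^esub> X)"

text \<open>
  An autoequivalence of an additive category preserves biproducts and is therefore additive, so
  additivity of the shift is not listed separately. In TR2, \<open>0\<close> may be any zero object; by TR1
  the choice makes no difference.
\<close>

locale puppe_triangulated = additive_category T
  for T :: "('o, 'm, 'x) triangulated_category_scheme" (structure) +
  assumes shift: "autoequivalence T (Shift_ob T) (Shift T)"
    and Dist_is_triangle: "Dist T X Y Z f g h \<Longrightarrow> is_triangle T X Y Z f g h"
    and TR1:
      "\<lbrakk>Dist T X Y Z f g h; is_triangle T X' Y' Z' f' g' h';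
        iso_arrow T X X' a; iso_arrow T Y Y' b; iso_arrow T Z Z' c;
        b \<cdot> f = f' \<cdot> a; c \<cdot> g = g' \<cdot> b; \<Sigma> a \<cdot> h = h' \<cdot> c\<rbrakk>
        \<Longrightarrow> Dist T X' Y' Z' f' g' h'"
    and TR2:
      "\<lbrakk>X \<in> Ob T; zero_object T Z\<rbrakk>
        \<Longrightarrow> Dist T X X Z (Id T X) (Zero T X Z) (Zero T Z (\<Sigma>\<^sub>o X))"
    and TR3:
      "Dist T X Y Z f g h
        \<Longrightarrow> Dist T Y Z (\<Sigma>\<^sub>o X) g h (Neg T (\<Sigma>\<^sub>o X) (\<Sigma>\<^sub>o Y) (\<Sigma> f))"
    and TR4:
      "\<lbrakk>X \<in> Ob T; Y \<in> Ob T; f \<in> Hom T X Y\<rbrakk> \<Longrightarrow> \<exists>Z g h. Dist T X Y Z f g h"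
    and TR5:
      "\<lbrakk>Dist T X Y Z f g h; Dist T X' Y' Z' f' g' h';
        a \<in> Hom T X X'; b \<in> Hom T Y Y'; b \<cdot> f = f' \<cdot> a\<rbrakk>
        \<Longrightarrow> \<exists>c \<in> Hom T Z Z'. c \<cdot> g = g' \<cdot> b \<and> \<Sigma> a \<cdot> h = h' \<cdot> c"

definition chosen_triangles ::
  "('o, 'm, 'x) triangulated_category_scheme \<Rightarrow> ('m \<Rightarrow> 'o) \<Rightarrow> ('m \<Rightarrow> 'm) \<Rightarrow> ('m \<Rightarrow> 'm) \<Rightarrow> bool"
where
  "chosen_triangles T cone u v \<longleftrightarrow>
     (\<forall>A \<in> Ob T. \<forall>B \<in> Ob T. \<forall>f \<in> Hom T A B. Dist T A B (cone f) f (u f) (v f))"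


section \<open>The homomorphism theta\<close>

definition Delta_sub ::
  "('o, 'm, 'x) triangulated_category_scheme \<Rightarrow> 'o \<Rightarrow> 'o \<Rightarrow> 'o \<Rightarrow> 'o \<Rightarrow> 'm \<Rightarrow> 'm \<Rightarrow> 'm set"
where
  "Delta_sub T A B A' B' f f' =
     {f' \<cdot>\<^bsub>T\<^esub> g \<^bold>+\<^bsub>T\<^esub> Neg T (\<Sigma>\<^sub>o\<^bsub>T\<^esub> A) B' (h \<cdot>\<^bsub>T\<^esub> \<Sigma>\<^bsub>T\<^esub> f) | g h.
        g \<in> Hom T (\<Sigma>\<^sub>o\<^bsub>T\<^esub> A) A' \<and> h \<in> Hom T (\<Sigma>\<^sub>o\<^bsub>T\<^esub> B) B'}"

definition Delta ::
  "('o, 'm, 'x) triangulated_category_scheme \<Rightarrow> 'o \<Rightarrow> 'o \<Rightarrow> 'o \<Rightarrow> 'o \<Rightarrow> 'm \<Rightarrow> 'm \<Rightarrow> 'm set monoid"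
where
  "Delta T A B A' B' f f' = hom_group T (\<Sigma>\<^sub>o\<^bsub>T\<^esub> A) B' Mod Delta_sub T A B A' B' f f'"

definition Theta ::
  "('o, 'm, 'x) triangulated_category_scheme \<Rightarrow> ('m \<Rightarrow> 'o) \<Rightarrow> ('m \<Rightarrow> 'm) \<Rightarrow> ('m \<Rightarrow> 'm) \<Rightarrow>
   'o \<Rightarrow> 'o \<Rightarrow> 'o \<Rightarrow> 'o \<Rightarrow> 'm \<Rightarrow> 'm \<Rightarrow> 'm monoid"
where
  "Theta T cone u v A B A' B' f f' = (hom_group T (cone f) (cone f'))
     \<lparr>carrier := {c \<in> Hom T (cone f) (cone f').
        c \<cdot>\<^bsub>T\<^esub> u f = Zero T B (cone f') \<and> v f' \<cdot>\<^bsub>T\<^esub> c = Zero T (cone f) (\<Sigma>\<^sub>o\<^bsub>T\<^esub> A')}\<rparr>"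

text \<open>
  The map induced on cosets by \<open>x \<mapsto> u\<^sub>f\<^sub>' \<cdot> x \<cdot> v\<^sub>f\<close>: the image of a coset is a singleton, as
  shown in \<open>theta_coset\<close> below.
\<close>

definition theta ::
  "('o, 'm, 'x) triangulated_category_scheme \<Rightarrow> ('m \<Rightarrow> 'm) \<Rightarrow> ('m \<Rightarrow> 'm) \<Rightarrow> 'm \<Rightarrow> 'm \<Rightarrow> 'm set \<Rightarrow> 'm"
where
  "theta T u v f f' X = the_elem ((\<lambda>x. u f' \<cdot>\<^bsub>T\<^esub> x \<cdot>\<^bsub>T\<^esub> v f) ` X)"


context additive_category
begin

lemma hom_group_simps [simp]:
  "carrier (hom_group C A B) = Hom C A B"
  "mult (hom_group C A B) = Add C"
  "one (hom_group C A B) = Zero C A B"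
  by (simp_all add: hom_group_def)

lemma hom_group: "\<lbrakk>A \<in> Ob C; B \<in> Ob C\<rbrakk> \<Longrightarrow> group (hom_group C A B)"
  using hom_comm_group by (simp add: comm_group_def)

lemma Zero_in_Hom: "\<lbrakk>A \<in> Ob C; B \<in> Ob C\<rbrakk> \<Longrightarrow> Zero C A B \<in> Hom C A B"
  using hom_group[THEN group.is_monoid, THEN monoid.one_closed] by simp

lemma Add_in_Hom:
  "\<lbrakk>A \<in> Ob C; B \<in> Ob C; f \<in> Hom C A B; g \<in> Hom C A B\<rbrakk> \<Longrightarrow> f \<^bold>+ g \<in> Hom C A B"
  using monoid.m_closed[OF group.is_monoid[OF hom_group], of A B f g] by simp

lemma Neg_in_Hom: "\<lbrakk>A \<in> Ob C; B \<in> Ob C; f \<in> Hom C A B\<rbrakk> \<Longrightarrow> Neg C A B f \<in> Hom C A B"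
  using group.inv_closed[OF hom_group, of A B f] by simp

lemma Zero_Add:
  "\<lbrakk>A \<in> Ob C; B \<in> Ob C; f \<in> Hom C A B\<rbrakk> \<Longrightarrow> Zero C A B \<^bold>+ f = f"
  using monoid.l_one[OF group.is_monoid[OF hom_group], of A B f] by simp

lemma Add_Neg:
  "\<lbrakk>A \<in> Ob C; B \<in> Ob C; f \<in> Hom C A B\<rbrakk> \<Longrightarrow> f \<^bold>+ Neg C A B f = Zero C A B"
  using group.r_inv[OF hom_group, of A B f] by simp

lemma idempotent_Zero:
  assumes "A \<in> Ob C" "B \<in> Ob C" "f \<in> Hom C A B" "f \<^bold>+ f = f"
  shows "f = Zero C A B"
  using group.l_cancel_one[OF hom_group, of A B f f] assms by simp

lemma Zero_Comp:
  assumes "A \<in> Ob C" "B \<in> Ob C" "D \<in> Ob C" "f \<in> Hom C A B"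
  shows "Zero C B D \<cdot> f = Zero C A D"
proof (rule idempotent_Zero)
  have "Zero C B D \<cdot> f \<^bold>+ Zero C B D \<cdot> f = (Zero C B D \<^bold>+ Zero C B D) \<cdot> f"
    using assms Zero_in_Hom[of B D] by (simp add: Comp_Add_left)
  then show "Zero C B D \<cdot> f \<^bold>+ Zero C B D \<cdot> f = Zero C B D \<cdot> f"
    using assms Zero_in_Hom[of B D] by (simp add: Zero_Add)
qed (use assms Zero_in_Hom Comp_in_Hom in auto)

lemma Comp_Zero:
  assumes "A \<in> Ob C" "B \<in> Ob C" "D \<in> Ob C" "f \<in> Hom C B D"
  shows "f \<cdot> Zero C A B = Zero C A D"
proof (rule idempotent_Zero)
  have "f \<cdot> Zero C A B \<^bold>+ f \<cdot> Zero C A B = f \<cdot> (Zero C A B \<^bold>+ Zero C A B)"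
    using assms Zero_in_Hom[of A B] by (simp add: Comp_Add_right)
  then show "f \<cdot> Zero C A B \<^bold>+ f \<cdot> Zero C A B = f \<cdot> Zero C A B"
    using assms Zero_in_Hom[of A B] by (simp add: Zero_Add)
qed (use assms Zero_in_Hom Comp_in_Hom in auto)

lemma Neg_Comp:
  assumes "A \<in> Ob C" "B \<in> Ob C" "D \<in> Ob C" "f \<in> Hom C A B" "g \<in> Hom C B D"
  shows "Neg C B D g \<cdot> f = Neg C A D (g \<cdot> f)"
proof -
  have "g \<cdot> f \<^bold>+ Neg C B D g \<cdot> f = (g \<^bold>+ Neg C B D g) \<cdot> f"
    using assms by (simp add: Comp_Add_left Neg_in_Hom)
  also have "\<dots> = Zero C A D"
    using assms by (simp add: Add_Neg Zero_Comp)
  finally show ?thesis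
    using group.inv_equality[OF hom_group, of A D "Neg C B D g \<cdot> f" "g \<cdot> f"]
      comm_monoid.m_comm[OF comm_group.axioms(1)[OF hom_comm_group], of A D "g \<cdot> f" "Neg C B D g \<cdot> f"]
      assms Comp_in_Hom[of A B D] Neg_in_Hom[of B D g]
    by simp
qed

end

context puppe_triangulated
begin

lemma Shift_ob_in_Ob: "X \<in> Ob T \<Longrightarrow> \<Sigma>\<^sub>o X \<in> Ob T"
  using shift by (simp add: autoequivalence_def is_functor_def)

lemma Shift_in_Hom:
  "\<lbrakk>X \<in> Ob T; Y \<in> Ob T; f \<in> Hom T X Y\<rbrakk> \<Longrightarrow> \<Sigma> f \<in> Hom T (\<Sigma>\<^sub>o X) (\<Sigma>\<^sub>o Y)"
  using shift by (simp add: autoequivalence_def is_functor_def)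

lemma Dist_comp_Zero:
  assumes D: "Dist T X Y Z f g h"
  shows "g \<cdot> f = Zero T X Z"
proof -
  have o: "X \<in> Ob T" "Y \<in> Ob T" "Z \<in> Ob T" and m: "f \<in> Hom T X Y" "g \<in> Hom T Y Z"
    using Dist_is_triangle[OF D] by (auto simp: is_triangle_def)
  obtain N where N: "zero_object T N" using zero_object_exists by blast
  then have No: "N \<in> Ob T" by (simp add: zero_object_def)
  have "f \<cdot> Id T X = f \<cdot> Id T X" ..
  then obtain c where c: "c \<in> Hom T N Z" "c \<cdot> Zero T X N = g \<cdot> f"
    using TR5[OF TR2[OF o(1) N] D Id_in_Hom[OF o(1)] m(1)] by blast
  then show ?thesis using Comp_Zero[of X N Z c] o No by simp
qed

lemma Dist_Shift_comp_Zero: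
  assumes D: "Dist T X Y Z f g h"
  shows "\<Sigma> f \<cdot> h = Zero T Z (\<Sigma>\<^sub>o Y)"
proof -
  have o: "X \<in> Ob T" "Y \<in> Ob T" "Z \<in> Ob T" and m: "f \<in> Hom T X Y" "h \<in> Hom T Z (\<Sigma>\<^sub>o X)"
    using Dist_is_triangle[OF D] by (auto simp: is_triangle_def)
  note S = Shift_ob_in_Ob[OF o(1)] Shift_ob_in_Ob[OF o(2)] Shift_in_Hom[OF o(1,2) m(1)]
  have "Neg T Z (\<Sigma>\<^sub>o Y) (\<Sigma> f \<cdot> h) = Zero T Z (\<Sigma>\<^sub>o Y)"
    using Dist_comp_Zero[OF TR3[OF TR3[OF D]]] Neg_Comp[of Z "\<Sigma>\<^sub>o X" "\<Sigma>\<^sub>o Y" h "\<Sigma> f"] o m S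
    by simp
  then show ?thesis
    using group.inv_inv[OF hom_group, of Z "\<Sigma>\<^sub>o Y" "\<Sigma> f \<cdot> h"]
      monoid.inv_one[OF group.is_monoid[OF hom_group], of Z "\<Sigma>\<^sub>o Y"]
      Comp_in_Hom[of Z "\<Sigma>\<^sub>o X" "\<Sigma>\<^sub>o Y" h "\<Sigma> f"] o m S
    by simp
qed

lemma theta_coset:
  assumes ch: "chosen_triangles T cone u v"
    and A: "A \<in> Ob T" "B \<in> Ob T" "f \<in> Hom T A B"
    and A': "A' \<in> Ob T" "B' \<in> Ob T" "f' \<in> Hom T A' B'"
    and x: "x \<in> Hom T (\<Sigma>\<^sub>o A) B'"
  shows "theta T u v f f' (Delta_sub T A B A' B' f f' #>\<^bsub>hom_group T (\<Sigma>\<^sub>o A) B'\<^esub> x)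
    = u f' \<cdot> x \<cdot> v f"
proof -
  let ?S = "Delta_sub T A B A' B' f f'" and ?A = "\<Sigma>\<^sub>o A" and ?B = "\<Sigma>\<^sub>o B"
  have D: "Dist T A B (cone f) f (u f) (v f)" and D': "Dist T A' B' (cone f') f' (u f') (v f')"
    using ch A A' by (auto simp: chosen_triangles_def)
  have o: "cone f \<in> Ob T" "cone f' \<in> Ob T" "?A \<in> Ob T" "?B \<in> Ob T"
    and m: "v f \<in> Hom T (cone f) ?A" "u f' \<in> Hom T B' (cone f')" "\<Sigma> f \<in> Hom T ?A ?B"
    using Dist_is_triangle[OF D] Dist_is_triangle[OF D'] Shift_ob_in_Ob Shift_in_Hom A
    by (auto simp: is_triangle_def)
  have vanish: "u f' \<cdot> d \<cdot> v f = Zero T (cone f) (cone f')" and d_Hom: "d \<in> Hom T ?A B'"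
    if "d \<in> ?S" for d
  proof -
    from that obtain g h where g: "g \<in> Hom T ?A A'" and h: "h \<in> Hom T ?B B'"
      and d: "d = f' \<cdot> g \<^bold>+ Neg T ?A B' (h \<cdot> \<Sigma> f)"
      by (auto simp: Delta_sub_def)
    have 1: "f' \<cdot> g \<in> Hom T ?A B'" "h \<cdot> \<Sigma> f \<in> Hom T ?A B'"
      using Comp_in_Hom[of ?A A' B' g f'] Comp_in_Hom[of ?A ?B B' "\<Sigma> f" h] g h o m A' by auto
    then have 2: "Neg T ?A B' (h \<cdot> \<Sigma> f) \<in> Hom T ?A B'" using Neg_in_Hom o A' by blast
    show dH: "d \<in> Hom T ?A B'" unfolding d using Add_in_Hom 1 2 o A' by blast
    have a: "u f' \<cdot> (f' \<cdot> g) = Zero T ?A (cone f')"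
      using Comp_assoc[of ?A A' B' "cone f'" g f' "u f'"] Dist_comp_Zero[OF D']
        Zero_Comp[of ?A A' "cone f'" g] g o m A' by simp
    have "(h \<cdot> \<Sigma> f) \<cdot> v f = Zero T (cone f) B'"
      using Comp_assoc[of "cone f" ?A ?B B' "v f" "\<Sigma> f" h] Dist_Shift_comp_Zero[OF D]
        Comp_Zero[of "cone f" ?B B' h] h o m A' by simp
    then have b: "Neg T ?A B' (h \<cdot> \<Sigma> f) \<cdot> v f = Zero T (cone f) B'"
      using Neg_Comp[of "cone f" ?A B' "v f" "h \<cdot> \<Sigma> f"] 1 o m A'
        monoid.inv_one[OF group.is_monoid[OF hom_group], of "cone f" B'] by simp
    have "u f' \<cdot> d = u f' \<cdot> Neg T ?A B' (h \<cdot> \<Sigma> f)"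
      unfolding d using Comp_Add_right[OF o(3) A'(2) o(2) 1(1) 2 m(2)] a
        Zero_Add[OF o(3,2) Comp_in_Hom[OF o(3) A'(2) o(2) 2 m(2)]] by simp
    then show "u f' \<cdot> d \<cdot> v f = Zero T (cone f) (cone f')"
      using Comp_assoc[OF o(1,3) A'(2) o(2) m(1) 2 m(2)] b
        Comp_Zero[OF o(1) A'(2) o(2) m(2)] by simp
  qed
  have "u f' \<cdot> (d \<^bold>+ x) \<cdot> v f = u f' \<cdot> x \<cdot> v f" if "d \<in> ?S" for d
  proof -
    note ud = Comp_in_Hom[OF o(3) A'(2) o(2) d_Hom[OF that] m(2)]
    note ux = Comp_in_Hom[OF o(3) A'(2) o(2) x m(2)]
    show ?thesis
      using Comp_Add_right[OF o(3) A'(2) o(2) d_Hom[OF that] x m(2)]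
        Comp_Add_left[OF o(1,3,2) m(1) ud ux] vanish[OF that]
        Zero_Add[OF o(1,2) Comp_in_Hom[OF o(1,3,2) m(1) ux]] by simp
  qed
  moreover have "?S \<noteq> {}"
    using Zero_in_Hom[OF o(3) A'(1)] Zero_in_Hom[OF o(4) A'(2)] by (auto simp: Delta_sub_def)
  ultimately have "(\<lambda>y. u f' \<cdot> y \<cdot> v f) ` (?S #>\<^bsub>hom_group T ?A B'\<^esub> x) = {u f' \<cdot> x \<cdot> v f}"
    by (auto simp: r_coset_def image_iff)
  then show ?thesis by (simp add: theta_def)
qed

end

end

theory Submission
  imports Defs
begin

text \<open>
  \<open>Hom(W, -)\<close> and \<open>Hom(-, W)\<close> are exact on distinguished triangles. If \<open>f s f = f\<close>, then
  \<open>f[1] (1 - s[1] f[1]) = 0\<close>, so \<open>1 = s[1] f[1] + v\<^sub>f t\<close> for some \<open>t : A[1] \<rightarrow> C\<^sub>f\<close>. If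
  \<open>u\<^sub>f\<^sub>' x v\<^sub>f = 0\<close>, then \<open>x v\<^sub>f = f' k\<close> for some \<open>k\<close>, and \<open>x = x s[1] f[1] + f' k t\<close> vanishes in
  \<open>\<Delta>(f, f')\<close>. If \<open>c u\<^sub>f = 0\<close> and \<open>v\<^sub>f\<^sub>' c = 0\<close>, then \<open>c = u\<^sub>f\<^sub>' b\<close> and \<open>c = y v\<^sub>f\<close>; as
  \<open>v\<^sub>f t v\<^sub>f = v\<^sub>f\<close>, \<open>c\<close> is the image of \<open>b t\<close>. If \<open>f'\<close> is splittable, argue dually with
  \<open>1 = f' s' + t u\<^sub>f\<^sub>'\<close>.
\<close>

section \<open>Arrow calculus, and why an autoequivalence is full and faithful\<close>

context category
begin

text \<open>\<open>Hom\<close> is unconstrained outside \<open>Ob\<close>, so membership of both end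
  objects is bundled with membership in the hom-set: one fact then types an arrow.\<close>

definition arr :: "'o \<Rightarrow> 'o \<Rightarrow> 'm \<Rightarrow> bool" where
  "arr X Y f \<longleftrightarrow> X \<in> Ob C \<and> Y \<in> Ob C \<and> f \<in> Hom C X Y"

lemma arr_Id: "X \<in> Ob C \<Longrightarrow> arr X X (Id C X)"
  by (simp add: arr_def Id_in_Hom)

lemma arr_Comp: "\<lbrakk>arr X Y f; arr Y Z g\<rbrakk> \<Longrightarrow> arr X Z (g \<cdot> f)"
  unfolding arr_def using Comp_in_Hom[of X Y Z f g] by blast

lemma arr_assoc: "\<lbrakk>arr W X f; arr X Y g; arr Y Z h\<rbrakk> \<Longrightarrow> h \<cdot> g \<cdot> f = h \<cdot> (g \<cdot> f)"
  unfolding arr_def using Comp_assoc[of W X Y Z f g h] by blast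

lemma arr_Comp_Id: "arr X Y f \<Longrightarrow> f \<cdot> Id C X = f"
  using Comp_Id[of X Y f] by (simp add: arr_def)

lemma arr_Id_Comp: "arr X Y f \<Longrightarrow> Id C Y \<cdot> f = f"
  using Id_Comp[of X Y f] by (simp add: arr_def)

lemma iso_arrow_inverse:
  assumes "iso_arrow C X Y i" "X \<in> Ob C" "Y \<in> Ob C"
  obtains j where "arr X Y i" "arr Y X j" "j \<cdot> i = Id C X" "i \<cdot> j = Id C Y"
  using assms unfolding iso_arrow_def arr_def by blast

lemma iso_arrow_cancel_left:
  assumes "iso_arrow C Y Z i" "Z \<in> Ob C" "arr X Y f" "arr X Y g" "i \<cdot> f = i \<cdot> g"
  shows "f = g"
proof -
  have "Y \<in> Ob C" using assms(3) by (simp add: arr_def)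
  then obtain j where i: "arr Y Z i" and j: "arr Z Y j" "j \<cdot> i = Id C Y"
    by (rule iso_arrow_inverse[OF assms(1) _ assms(2)])
  show ?thesis
    using arr_assoc[OF assms(3) i j(1)] arr_assoc[OF assms(4) i j(1)] j(2) assms(5)
      arr_Id_Comp[OF assms(3)] arr_Id_Comp[OF assms(4)] by simp
qed

lemma iso_arrow_cancel_right:
  assumes "iso_arrow C X Y i" "X \<in> Ob C" "arr Y Z f" "arr Y Z g" "f \<cdot> i = g \<cdot> i"
  shows "f = g"
proof -
  have "Y \<in> Ob C" using assms(3) by (simp add: arr_def)
  then obtain j where i: "arr X Y i" and j: "arr Y X j" "i \<cdot> j = Id C Y"
    by (rule iso_arrow_inverse[OF assms(1,2)])
  show ?thesis
    using arr_assoc[OF j(1) i assms(3)] arr_assoc[OF j(1) i assms(4)] j(2) assms(5)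
      arr_Comp_Id[OF assms(3)] arr_Comp_Id[OF assms(4)] by metis
qed

lemma functor_Ob: "\<lbrakk>is_functor C C Fo Fm; X \<in> Ob C\<rbrakk> \<Longrightarrow> Fo X \<in> Ob C"
  by (simp add: is_functor_def)

lemma functor_arr: "\<lbrakk>is_functor C C Fo Fm; arr X Y f\<rbrakk> \<Longrightarrow> arr (Fo X) (Fo Y) (Fm f)"
  by (simp add: is_functor_def arr_def)

lemma natural_iso_component:
  "\<lbrakk>natural_iso C C Fo Fm Go Gm \<eta>; X \<in> Ob C\<rbrakk> \<Longrightarrow> iso_arrow C (Fo X) (Go X) (\<eta> X)"
  by (simp add: natural_iso_def)

lemma natural_iso_naturality:
  "\<lbrakk>natural_iso C C Fo Fm Go Gm \<eta>; arr X Y f\<rbrakk> \<Longrightarrow> \<eta> Y \<cdot> Fm f = Gm f \<cdot> \<eta> X"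
  by (simp add: natural_iso_def arr_def)

text \<open>Naturality of the unit gives
  \<open>\<eta> Y \<cdot> f = Gm (Fm f) \<cdot> \<eta> X\<close>, so \<open>Fm f\<close> determines
  \<open>\<eta> Y \<cdot> f\<close>, and the isomorphism \<open>\<eta> Y\<close> cancels.\<close>

lemma autoequivalence_faithful:
  assumes "autoequivalence C Fo Fm" "arr X Y f" "arr X Y g" "Fm f = Fm g"
  shows "f = g"
proof -
  obtain Go Gm \<eta> where F: "is_functor C C Fo Fm" and G: "is_functor C C Go Gm"
    and \<eta>: "natural_iso C C id id (Go \<circ> Fo) (Gm \<circ> Fm) \<eta>"
    using assms(1) unfolding autoequivalence_def by blast
  have Y: "Y \<in> Ob C" using assms(2) by (simp add: arr_def)
  have "\<eta> Y \<cdot> f = \<eta> Y \<cdot> g"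
    using natural_iso_naturality[OF \<eta> assms(2)] natural_iso_naturality[OF \<eta> assms(3)] assms(4)
    by simp
  moreover have "iso_arrow C Y (Go (Fo Y)) (\<eta> Y)"
    using natural_iso_component[OF \<eta> Y] by simp
  ultimately show ?thesis
    using iso_arrow_cancel_left[OF _ functor_Ob[OF G functor_Ob[OF F Y]] assms(2,3)] by simp
qed

text \<open>The preimage of \<open>k\<close> is \<open>Gm k\<close> transported along the unit: the
  inverse of \<open>\<eta> Y\<close>, after \<open>Gm k\<close>, after \<open>\<eta> X\<close>. By
  naturality of \<open>\<eta>\<close> its image under \<open>Fm\<close> agrees with \<open>k\<close>
  once \<open>Gm\<close> is applied.\<close>

lemma autoequivalence_full:
  assumes "autoequivalence C Fo Fm" "X \<in> Ob C" "Y \<in> Ob C" "arr (Fo X) (Fo Y) k"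
  obtains f where "arr X Y f" "Fm f = k"
proof -
  obtain Go Gm \<eta> \<epsilon> where F: "is_functor C C Fo Fm" and G: "is_functor C C Go Gm"
    and \<eta>: "natural_iso C C id id (Go \<circ> Fo) (Gm \<circ> Fm) \<eta>"
    and \<epsilon>: "natural_iso C C (Fo \<circ> Go) (Fm \<circ> Gm) id id \<epsilon>"
    using assms(1) unfolding autoequivalence_def by blast
  note FX = functor_Ob[OF F assms(2)] and FY = functor_Ob[OF F assms(3)]
  note GFX = functor_Ob[OF G FX] and GFY = functor_Ob[OF G FY]
  have iX: "iso_arrow C X (Go (Fo X)) (\<eta> X)" and iY: "iso_arrow C Y (Go (Fo Y)) (\<eta> Y)"
    using natural_iso_component[OF \<eta> assms(2)] natural_iso_component[OF \<eta> assms(3)] by simp_all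
  obtain j where aY: "arr Y (Go (Fo Y)) (\<eta> Y)"
    and j: "arr (Go (Fo Y)) Y j" "\<eta> Y \<cdot> j = Id C (Go (Fo Y))"
    by (rule iso_arrow_inverse[OF iY assms(3) GFY])
  have aX: "arr X (Go (Fo X)) (\<eta> X)" by (rule iso_arrow_inverse[OF iX assms(2) GFX])
  define f where "f = j \<cdot> (Gm k \<cdot> \<eta> X)"
  note Gk = functor_arr[OF G assms(4)]
  note Gk\<eta> = arr_Comp[OF aX Gk]
  have f: "arr X Y f" unfolding f_def using arr_Comp[OF Gk\<eta> j(1)] .
  note Ff = functor_arr[OF F f]
  note GFf = functor_arr[OF G Ff]
  have "Gm (Fm f) \<cdot> \<eta> X = \<eta> Y \<cdot> f"
    using natural_iso_naturality[OF \<eta> f] by simp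
  also have "\<dots> = Gm k \<cdot> \<eta> X"
    unfolding f_def using arr_assoc[OF Gk\<eta> j(1) aY] j(2) arr_Id_Comp[OF Gk\<eta>] by simp
  finally have GF: "Gm (Fm f) = Gm k"
    using iso_arrow_cancel_right[OF iX assms(2) GFf Gk] by simp
  \<comment> \<open>The counit removes \<open>Gm\<close>: by naturality both sides equal the counit
    at \<open>Fo Y\<close> composed with the common value of \<open>Fm (Gm (Fm f))\<close> and
    \<open>Fm (Gm k)\<close>.\<close>
  have "Fm f \<cdot> \<epsilon> (Fo X) = k \<cdot> \<epsilon> (Fo X)"
    using natural_iso_naturality[OF \<epsilon> Ff] natural_iso_naturality[OF \<epsilon> assms(4)] GF by simp
  moreover have "iso_arrow C (Fo (Go (Fo X))) (Fo X) (\<epsilon> (Fo X))"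
    using natural_iso_component[OF \<epsilon> FX] by simp
  ultimately have "Fm f = k"
    using iso_arrow_cancel_right[OF _ functor_Ob[OF F GFX] Ff assms(4)] by simp
  then show thesis using that f by blast
qed

end

section \<open>Additive calculus and complements of the idempotents of a splitting\<close>

context additive_category
begin

lemma arr_Zero: "\<lbrakk>X \<in> Ob C; Y \<in> Ob C\<rbrakk> \<Longrightarrow> arr X Y (Zero C X Y)"
  by (simp add: arr_def Zero_in_Hom)

lemma arr_Add: "\<lbrakk>arr X Y f; arr X Y g\<rbrakk> \<Longrightarrow> arr X Y (f \<^bold>+ g)"
  by (simp add: arr_def Add_in_Hom)

lemma arr_Neg: "arr X Y f \<Longrightarrow> arr X Y (Neg C X Y f)"
  by (simp add: arr_def Neg_in_Hom)

lemma arr_Zero_Comp: "\<lbrakk>arr X Y f; Z \<in> Ob C\<rbrakk> \<Longrightarrow> Zero C Y Z \<cdot> f = Zero C X Z"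
  using Zero_Comp[of X Y Z f] by (simp add: arr_def)

lemma arr_Comp_Zero: "\<lbrakk>arr Y Z f; X \<in> Ob C\<rbrakk> \<Longrightarrow> f \<cdot> Zero C X Y = Zero C X Z"
  using Comp_Zero[of X Y Z f] by (simp add: arr_def)

lemma arr_Add_Comp:
  "\<lbrakk>arr X Y f; arr Y Z g; arr Y Z h\<rbrakk> \<Longrightarrow> (g \<^bold>+ h) \<cdot> f = g \<cdot> f \<^bold>+ h \<cdot> f"
  using Comp_Add_left[of X Y Z f g h] by (simp add: arr_def)

lemma arr_Comp_Add:
  "\<lbrakk>arr X Y f; arr X Y g; arr Y Z h\<rbrakk> \<Longrightarrow> h \<cdot> (f \<^bold>+ g) = h \<cdot> f \<^bold>+ h \<cdot> g"
  using Comp_Add_right[of X Y Z f g h] by (simp add: arr_def)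

lemma arr_Zero_Add: "arr X Y f \<Longrightarrow> Zero C X Y \<^bold>+ f = f"
  using Zero_Add[of X Y f] by (simp add: arr_def)

lemma arr_Add_Neg: "arr X Y f \<Longrightarrow> f \<^bold>+ Neg C X Y f = Zero C X Y"
  using Add_Neg[of X Y f] by (simp add: arr_def)

lemma arr_Add_assoc:
  "\<lbrakk>arr X Y f; arr X Y g; arr X Y h\<rbrakk> \<Longrightarrow> f \<^bold>+ g \<^bold>+ h = f \<^bold>+ (g \<^bold>+ h)"
  using monoid.m_assoc[OF group.is_monoid[OF hom_group], of X Y f g h] by (simp add: arr_def)

lemma arr_Add_commute: "\<lbrakk>arr X Y f; arr X Y g\<rbrakk> \<Longrightarrow> f \<^bold>+ g = g \<^bold>+ f"
  using comm_monoid.m_comm[OF comm_group.axioms(1)[OF hom_comm_group], of X Y f g]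
  by (simp add: arr_def)

lemma arr_Neg_Neg: "arr X Y f \<Longrightarrow> Neg C X Y (Neg C X Y f) = f"
  using group.inv_inv[OF hom_group, of X Y f] by (simp add: arr_def)

lemma Neg_Zero: "\<lbrakk>X \<in> Ob C; Y \<in> Ob C\<rbrakk> \<Longrightarrow> Neg C X Y (Zero C X Y) = Zero C X Y"
  using monoid.inv_one[OF group.is_monoid[OF hom_group], of X Y] by simp

lemma arr_Neg_Comp: "\<lbrakk>arr X Y f; arr Y Z g\<rbrakk> \<Longrightarrow> Neg C Y Z g \<cdot> f = Neg C X Z (g \<cdot> f)"
  using Neg_Comp[of X Y Z f g] by (simp add: arr_def)

lemma arr_Comp_Neg:
  assumes "arr X Y f" "arr Y Z g"
  shows "g \<cdot> Neg C X Y f = Neg C X Z (g \<cdot> f)"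
proof -
  note n = arr_Neg[OF assms(1)] and gf = arr_Comp[OF assms]
  note gn = arr_Comp[OF n assms(2)]
  have o: "X \<in> Ob C" "Y \<in> Ob C" "Z \<in> Ob C"
    using assms by (auto simp: arr_def)
  have "g \<cdot> Neg C X Y f \<^bold>+ g \<cdot> f = g \<cdot> (f \<^bold>+ Neg C X Y f)"
    using arr_Comp_Add[OF assms(1) n assms(2)] arr_Add_commute[OF gn gf] by simp
  also have "\<dots> = Zero C X Z"
    using arr_Add_Neg[OF assms(1)] arr_Comp_Zero[OF assms(2) o(1)] by simp
  finally show ?thesis
    using group.inv_equality[OF hom_group[OF o(1,3)], of "g \<cdot> Neg C X Y f" "g \<cdot> f"] gf gn
    by (simp add: arr_def)
qed

lemma arr_Neg_inject:
  assumes "arr X Y f" "arr X Y g" "Neg C X Y f = Neg C X Y g"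
  shows "f = g"
  by (metis assms arr_Neg_Neg)

lemma arr_Diff_Add:
  assumes "arr X Y f" "arr X Y g"
  shows "g \<^bold>+ (f \<^bold>+ Neg C X Y g) = f"
proof -
  note n = arr_Neg[OF assms(2)]
  have "g \<^bold>+ (f \<^bold>+ Neg C X Y g) = f \<^bold>+ Neg C X Y g \<^bold>+ g"
    using arr_Add_commute[OF assms(2) arr_Add[OF assms(1) n]] .
  also have "\<dots> = f \<^bold>+ (g \<^bold>+ Neg C X Y g)"
    using arr_Add_assoc[OF assms(1) n assms(2)] arr_Add_commute[OF n assms(2)] by simp
  also have "\<dots> = f"
    using arr_Add_Neg[OF assms(2)] arr_Add_commute[OF assms(1) arr_Zero] arr_Zero_Add[OF assms(1)]
      assms(1) by (simp add: arr_def)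
  finally show ?thesis .
qed

text \<open>The endomorphism \<open>s \<cdot> f\<close> is idempotent; \<open>p\<close> is its
  complement \<open>1 - s f\<close>, and \<open>f p = f - f s f = 0\<close>.\<close>

lemma split_right:
  assumes f: "arr X Y f" and s: "arr Y X s" and fsf: "f \<cdot> s \<cdot> f = f"
  obtains p where "arr X X p" "f \<cdot> p = Zero C X Y" "s \<cdot> f \<^bold>+ p = Id C X"
proof
  let ?p = "Id C X \<^bold>+ Neg C X X (s \<cdot> f)"
  have o: "X \<in> Ob C" using f by (simp add: arr_def)
  note i = arr_Id[OF o] and sf = arr_Comp[OF f s]
  note n = arr_Neg[OF sf]
  show "arr X X ?p" using arr_Add[OF i n] .
  show "f \<cdot> ?p = Zero C X Y"
    using arr_Comp_Add[OF i n f] arr_Comp_Id[OF f] arr_Comp_Neg[OF sf f] arr_assoc[OF f s f] fsf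
      arr_Add_Neg[OF f] by simp
  show "s \<cdot> f \<^bold>+ ?p = Id C X" using arr_Diff_Add[OF i sf] .
qed

text \<open>Dual to \<open>split_right\<close>, with \<open>p = 1 - f s\<close>.\<close>

lemma split_left:
  assumes f: "arr X Y f" and s: "arr Y X s" and fsf: "f \<cdot> s \<cdot> f = f"
  obtains p where "arr Y Y p" "p \<cdot> f = Zero C X Y" "f \<cdot> s \<^bold>+ p = Id C Y"
proof
  let ?p = "Id C Y \<^bold>+ Neg C Y Y (f \<cdot> s)"
  have o: "Y \<in> Ob C" using f by (simp add: arr_def)
  note i = arr_Id[OF o] and fs = arr_Comp[OF s f]
  note n = arr_Neg[OF fs]
  show "arr Y Y ?p" using arr_Add[OF i n] .
  show "?p \<cdot> f = Zero C X Y"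
    using arr_Add_Comp[OF f i n] arr_Id_Comp[OF f] arr_Neg_Comp[OF f fs] fsf
      arr_Add_Neg[OF f] by simp
  show "f \<cdot> s \<^bold>+ ?p = Id C Y" using arr_Diff_Add[OF i fs] .
qed

end

section \<open>Exactness of Hom on distinguished triangles\<close>

context puppe_triangulated
begin

lemma arr_Shift: "arr X Y f \<Longrightarrow> arr (\<Sigma>\<^sub>o X) (\<Sigma>\<^sub>o Y) (\<Sigma> f)"
  by (simp add: arr_def Shift_ob_in_Ob Shift_in_Hom)

lemma Shift_Comp: "\<lbrakk>arr X Y f; arr Y Z g\<rbrakk> \<Longrightarrow> \<Sigma> (g \<cdot> f) = \<Sigma> g \<cdot> \<Sigma> f"
  using shift unfolding autoequivalence_def is_functor_def arr_def by blast

lemma Shift_Id: "X \<in> Ob T \<Longrightarrow> \<Sigma> (Id T X) = Id T (\<Sigma>\<^sub>o X)"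
  using shift by (simp add: autoequivalence_def is_functor_def)

lemma Dist_arr:
  assumes "Dist T X Y Z f g h"
  shows "arr X Y f" "arr Y Z g" "arr Z (\<Sigma>\<^sub>o X) h"
  using Dist_is_triangle[OF assms] Shift_ob_in_Ob by (auto simp: is_triangle_def arr_def)

text \<open>As the shift is full, the zero endomorphism of \<open>\<Sigma>\<^sub>o N\<close> is the
  shift of an endomorphism of \<open>N\<close>. The only one is the identity, so the identity of
  \<open>\<Sigma>\<^sub>o N\<close> is zero.\<close>

lemma arr_to_Shift_zero_object:
  assumes N: "zero_object T N" and x: "arr X (\<Sigma>\<^sub>o N) x"
  shows "x = Zero T X (\<Sigma>\<^sub>o N)"
proof -
  have No: "N \<in> Ob T" using N by (simp add: zero_object_def)
  note SN = Shift_ob_in_Ob[OF No]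
  obtain z where z: "arr N N z" "\<Sigma> z = Zero T (\<Sigma>\<^sub>o N) (\<Sigma>\<^sub>o N)"
    using autoequivalence_full[OF shift No No arr_Zero[OF SN SN]] .
  have "z = Id T N"
    using N No z(1) arr_Id[OF No] unfolding zero_object_def arr_def by blast
  then have "Id T (\<Sigma>\<^sub>o N) = Zero T (\<Sigma>\<^sub>o N) (\<Sigma>\<^sub>o N)"
    using z(2) Shift_Id[OF No] by simp
  then show ?thesis using arr_Id_Comp[OF x] arr_Zero_Comp[OF x SN] by simp
qed

text \<open>
  The triangle \<open>W \<rightarrow> 0 \<rightarrow> W[1]\<close> is mapped to \<open>Y \<rightarrow> Z \<rightarrow> X[1]\<close>, and the resulting
  \<open>W[1] \<rightarrow> X[1]\<close> is desuspended.
\<close>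

lemma Dist_lift:
  assumes D: "Dist T X Y Z f g h" and y: "arr W Y y" and gy: "g \<cdot> y = Zero T W Z"
  obtains x where "arr W X x" "f \<cdot> x = y"
proof -
  note a = Dist_arr[OF D]
  have o: "W \<in> Ob T" "X \<in> Ob T" "Z \<in> Ob T" using a y by (auto simp: arr_def)
  obtain N where N: "zero_object T N" using zero_object_exists by blast
  then have No: "N \<in> Ob T" by (simp add: zero_object_def)
  have "Zero T N Z \<cdot> Zero T W N = g \<cdot> y"
    using arr_Zero_Comp[OF arr_Zero[OF o(1) No] o(3)] gy by simp
  then obtain c where c: "c \<in> Hom T (\<Sigma>\<^sub>o W) (\<Sigma>\<^sub>o X)"
    and eq: "\<Sigma> y \<cdot> Neg T (\<Sigma>\<^sub>o W) (\<Sigma>\<^sub>o W) (\<Sigma> (Id T W)) = Neg T (\<Sigma>\<^sub>o X) (\<Sigma>\<^sub>o Y) (\<Sigma> f) \<cdot> c"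
    using TR5[OF TR3[OF TR2[OF o(1) N]] TR3[OF D], of y "Zero T N Z"] y arr_Zero[OF No o(3)]
    unfolding arr_def by auto
  have "arr (\<Sigma>\<^sub>o W) (\<Sigma>\<^sub>o X) c" using c o Shift_ob_in_Ob by (simp add: arr_def)
  then obtain x where x: "arr W X x" "\<Sigma> x = c"
    using autoequivalence_full[OF shift o(1,2)] by blast
  note S = arr_Shift[OF y] arr_Shift[OF x(1)] arr_Shift[OF a(1)]
  note fx = arr_Comp[OF x(1) a(1)]
  \<comment> \<open>Both rotated triangles carry a sign in their last map, so the two signs
    cancel.\<close>
  have "Neg T (\<Sigma>\<^sub>o W) (\<Sigma>\<^sub>o Y) (\<Sigma> y) = Neg T (\<Sigma>\<^sub>o W) (\<Sigma>\<^sub>o Y) (\<Sigma> (f \<cdot> x))"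
    using eq arr_Comp_Neg[OF arr_Id S(1)] arr_Neg_Comp[OF S(2,3)] Shift_Comp[OF x(1) a(1)]
      Shift_Id[OF o(1)] Shift_ob_in_Ob[OF o(1)] arr_Comp_Id[OF S(1)] x(2) by simp
  then have "\<Sigma> (f \<cdot> x) = \<Sigma> y"
    using arr_Neg_inject[OF S(1) arr_Shift[OF fx]] by simp
  then have "f \<cdot> x = y" using autoequivalence_faithful[OF shift fx y] by simp
  then show thesis using that x(1) by blast
qed

text \<open>
  In fact \<open>g\<close> is an isomorphism. This replaces the triangle \<open>0 \<rightarrow> W \<rightarrow> W \<rightarrow> 0\<close>, which the axioms
  do not provide directly since TR3 rotates in one direction only.
\<close>

lemma Dist_from_zero_object_retraction:
  assumes N: "zero_object T N" and D: "Dist T N W Z i g h"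
  obtains r where "arr Z W r" "r \<cdot> g = Id T W"
proof -
  note a = Dist_arr[OF D]
  have o: "W \<in> Ob T" "N \<in> Ob T" "Z \<in> Ob T" "\<Sigma>\<^sub>o N \<in> Ob T" using a by (auto simp: arr_def)
  have h: "h = Zero T Z (\<Sigma>\<^sub>o N)" using arr_to_Shift_zero_object[OF N a(3)] .
  then have "h \<cdot> Id T Z = Zero T Z (\<Sigma>\<^sub>o N)" using arr_Comp_Id[OF a(3)] by simp
  \<comment> \<open>Since \<open>h = 0\<close>, exactness at \<open>Z\<close> lifts the identity of
    \<open>Z\<close> along \<open>g\<close>, giving a right inverse.\<close>
  then obtain r where r: "arr Z W r" "g \<cdot> r = Id T Z"
    using Dist_lift[OF TR3[OF D] arr_Id[OF o(3)]] by blast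
  note rg = arr_Comp[OF a(2) r(1)]
  \<comment> \<open>The defect of \<open>r\<close> as a left inverse. From \<open>g r = 1\<close>
    follows \<open>g d = 0\<close>, so \<open>d\<close> factors through \<open>i\<close>, which
    vanishes because its source is a zero object.\<close>
  let ?d = "Id T W \<^bold>+ Neg T W W (r \<cdot> g)"
  have d: "arr W W ?d" using arr_Add[OF arr_Id[OF o(1)] arr_Neg[OF rg]] .
  have "g \<cdot> ?d = g \<^bold>+ Neg T W Z (g \<cdot> (r \<cdot> g))"
    using arr_Comp_Add[OF arr_Id[OF o(1)] arr_Neg[OF rg] a(2)] arr_Comp_Id[OF a(2)]
      arr_Comp_Neg[OF rg a(2)] by simp
  also have "\<dots> = Zero T W Z"
    using arr_assoc[OF a(2) r(1) a(2)] r(2) arr_Id_Comp[OF a(2)] arr_Add_Neg[OF a(2)] by simp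
  finally obtain n where n: "arr W N n" "i \<cdot> n = ?d" using Dist_lift[OF D d] by blast
  have "i = Zero T N W"
    using N o(1) a(1) arr_Zero[OF o(2,1)] unfolding zero_object_def arr_def by blast
  then have "?d = Zero T W W" using n arr_Zero_Comp[OF n(1) o(1)] by simp
  then have "r \<cdot> g \<^bold>+ Zero T W W = Id T W"
    using arr_Diff_Add[OF arr_Id[OF o(1)] rg] by simp
  then have "r \<cdot> g = Id T W"
    using arr_Add_commute[OF rg arr_Zero[OF o(1,1)]] arr_Zero_Add[OF rg] by simp
  then show thesis using that r(1) by blast
qed

text \<open>The square with \<open>y\<close> and the zero map \<open>X \<rightarrow> N\<close>
  commutes because \<open>y f = 0\<close>. TR5 maps the given triangle to one on
  \<open>N \<rightarrow> W\<close>, which yields \<open>c\<close> with \<open>c g = j y\<close>; the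
  retraction \<open>r\<close> of \<open>j\<close> turns \<open>c\<close> into the extension
  \<open>r c\<close>.\<close>

lemma Dist_extend:
  assumes D: "Dist T X Y Z f g h" and y: "arr Y W y" and yf: "y \<cdot> f = Zero T X W"
  obtains z where "arr Z W z" "z \<cdot> g = y"
proof -
  note a = Dist_arr[OF D]
  have o: "W \<in> Ob T" "X \<in> Ob T" using a y by (auto simp: arr_def)
  obtain N where N: "zero_object T N" using zero_object_exists by blast
  then have No: "N \<in> Ob T" by (simp add: zero_object_def)
  note z = arr_Zero[OF No o(1)] arr_Zero[OF o(2) No]
  obtain V j k where E: "Dist T N W V (Zero T N W) j k"
    using TR4[OF No o(1)] z(1) unfolding arr_def by blast
  note e = Dist_arr[OF E]
  obtain r where r: "arr V W r" "r \<cdot> j = Id T W"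
    using Dist_from_zero_object_retraction[OF N E] .
  have "y \<cdot> f = Zero T N W \<cdot> Zero T X N"
    using arr_Zero_Comp[OF z(2) o(1)] yf by simp
  then obtain c where c: "arr Z V c" "c \<cdot> g = j \<cdot> y"
    using TR5[OF D E, of "Zero T X N" y] z(2) y e(2) a(2) unfolding arr_def by blast
  have "r \<cdot> c \<cdot> g = y"
    using arr_assoc[OF a(2) c(1) r(1)] c(2) arr_assoc[OF y e(2) r(1)] r(2) arr_Id_Comp[OF y]
    by simp
  then show thesis using that arr_Comp[OF c(1) r(1)] by blast
qed

text \<open>Exactness at \<open>\<Sigma>\<^sub>o X\<close>, read off from the triangle rotated
  twice. The sign on \<open>\<Sigma> f\<close> does not affect the vanishing condition.\<close>

lemma Dist_lift_Shift:
  assumes D: "Dist T X Y Z f g h" and y: "arr W (\<Sigma>\<^sub>o X) y" and fy: "\<Sigma> f \<cdot> y = Zero T W (\<Sigma>\<^sub>o Y)"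
  obtains x where "arr W Z x" "h \<cdot> x = y"
proof -
  note S = arr_Shift[OF Dist_arr(1)[OF D]]
  have "Neg T (\<Sigma>\<^sub>o X) (\<Sigma>\<^sub>o Y) (\<Sigma> f) \<cdot> y = Zero T W (\<Sigma>\<^sub>o Y)"
    using arr_Neg_Comp[OF y S] fy Neg_Zero y S by (simp add: arr_def)
  then show thesis using Dist_lift[OF TR3[OF TR3[OF D]] y] that by blast
qed

text \<open>Again the triangle rotated twice; here the sign on \<open>\<Sigma> f\<close> is absorbed
  by negating the extension.\<close>

lemma Dist_extend_Shift:
  assumes D: "Dist T X Y Z f g h" and y: "arr (\<Sigma>\<^sub>o X) W y" and yh: "y \<cdot> h = Zero T Z W"
  obtains z where "arr (\<Sigma>\<^sub>o Y) W z" "z \<cdot> \<Sigma> f = y"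
proof -
  note S = arr_Shift[OF Dist_arr(1)[OF D]]
  obtain z where z: "arr (\<Sigma>\<^sub>o Y) W z" "z \<cdot> Neg T (\<Sigma>\<^sub>o X) (\<Sigma>\<^sub>o Y) (\<Sigma> f) = y"
    using Dist_extend[OF TR3[OF TR3[OF D]] y yh] by blast
  then have "Neg T (\<Sigma>\<^sub>o Y) W z \<cdot> \<Sigma> f = y"
    using arr_Comp_Neg[OF S z(1)] arr_Neg_Comp[OF S z(1)] by simp
  then show thesis using that arr_Neg[OF z(1)] by blast
qed

section \<open>Decompositions of the identity from a splitting\<close>

text \<open>The shift carries a splitting of \<open>f\<close> to a splitting \<open>s\<close> of
  \<open>\<Sigma> f\<close>. The complement \<open>1 - s \<Sigma> f\<close> is killed by
  \<open>\<Sigma> f\<close>, hence lifts along \<open>h\<close> to \<open>t\<close>. Composing the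
  decomposition with \<open>h\<close> on the right gives \<open>h t h = h\<close>, as
  \<open>\<Sigma> f \<cdot> h = 0\<close>.\<close>

lemma splittable_split_right:
  assumes D: "Dist T X Y Z f g h" and sp: "splittable T X Y f"
  obtains s t where "arr (\<Sigma>\<^sub>o Y) (\<Sigma>\<^sub>o X) s" "arr (\<Sigma>\<^sub>o X) Z t"
    "s \<cdot> \<Sigma> f \<^bold>+ h \<cdot> t = Id T (\<Sigma>\<^sub>o X)" "h \<cdot> (t \<cdot> h) = h"
proof -
  note a = Dist_arr[OF D]
  obtain r where r: "arr Y X r" "f \<cdot> r \<cdot> f = f"
    using sp a(1) unfolding splittable_def arr_def by blast
  note S = arr_Shift[OF a(1)] arr_Shift[OF r(1)]
  have "\<Sigma> f \<cdot> \<Sigma> r \<cdot> \<Sigma> f = \<Sigma> f"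
    using Shift_Comp[OF r(1) a(1)] Shift_Comp[OF a(1) arr_Comp[OF r(1) a(1)]] r(2) by simp
  then obtain p where p: "arr (\<Sigma>\<^sub>o X) (\<Sigma>\<^sub>o X) p" "\<Sigma> f \<cdot> p = Zero T (\<Sigma>\<^sub>o X) (\<Sigma>\<^sub>o Y)"
    "\<Sigma> r \<cdot> \<Sigma> f \<^bold>+ p = Id T (\<Sigma>\<^sub>o X)"
    by (rule split_right[OF S])
  obtain t where t: "arr (\<Sigma>\<^sub>o X) Z t" "h \<cdot> t = p" using Dist_lift_Shift[OF D p(1,2)] .
  have o: "Z \<in> Ob T" using a by (simp add: arr_def)
  note th = arr_Comp[OF a(3) t(1)]
  note hth = arr_Comp[OF th a(3)]
  have "\<Sigma> r \<cdot> \<Sigma> f \<cdot> h = Zero T Z (\<Sigma>\<^sub>o X)"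
    using arr_assoc[OF a(3) S] Dist_Shift_comp_Zero[OF D] arr_Comp_Zero[OF S(2) o] by simp
  then have "(\<Sigma> r \<cdot> \<Sigma> f \<^bold>+ p) \<cdot> h = h \<cdot> (t \<cdot> h)"
    using arr_Add_Comp[OF a(3) arr_Comp[OF S] p(1)] t(2) arr_assoc[OF a(3) t(1) a(3)]
      arr_Zero_Add[OF hth] by simp
  then have "h \<cdot> (t \<cdot> h) = h" using p(3) arr_Id_Comp[OF a(3)] by simp
  then show thesis using that[OF S(2) t(1)] p(3) t(2) by simp
qed

text \<open>Dual: the complement \<open>1 - f s\<close> kills \<open>f\<close>, hence extends along
  \<open>g\<close> to \<open>t\<close>, and \<open>g f = 0\<close> gives
  \<open>g t g = g\<close>.\<close>

lemma splittable_split_left: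
  assumes D: "Dist T X Y Z f g h" and sp: "splittable T X Y f"
  obtains s t where "arr Y X s" "arr Z Y t" "f \<cdot> s \<^bold>+ t \<cdot> g = Id T Y" "g \<cdot> (t \<cdot> g) = g"
proof -
  note a = Dist_arr[OF D]
  obtain s where s: "arr Y X s" "f \<cdot> s \<cdot> f = f"
    using sp a(1) unfolding splittable_def arr_def by blast
  obtain p where p: "arr Y Y p" "p \<cdot> f = Zero T X Y" "f \<cdot> s \<^bold>+ p = Id T Y"
    using split_left[OF a(1) s] .
  obtain t where t: "arr Z Y t" "t \<cdot> g = p" using Dist_extend[OF D p(1,2)] .
  have o: "Z \<in> Ob T" using a by (simp add: arr_def)
  have "g \<cdot> (f \<cdot> s) = Zero T Y Z"
    using arr_assoc[OF s(1) a(1,2)] Dist_comp_Zero[OF D] arr_Zero_Comp[OF s(1) o] by simp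
  then have "g \<cdot> (f \<cdot> s \<^bold>+ p) = g \<cdot> p"
    using arr_Comp_Add[OF arr_Comp[OF s(1) a(1)] p(1) a(2)] arr_Zero_Add[OF arr_Comp[OF p(1) a(2)]]
    by simp
  then have "g \<cdot> (t \<cdot> g) = g" using p(3) t(2) arr_Comp_Id[OF a(2)] by simp
  then show thesis using that[OF s(1) t(1)] p(3) t(2) by simp
qed

section \<open>Kernel and image of the map on representatives\<close>

text \<open>The difference in \<open>Delta_sub\<close> may be replaced by a sum, because
  \<open>h\<close> ranges over a group.\<close>

lemma Delta_subI:
  assumes f: "arr A B f" and f': "arr A' B' f'"
    and g: "arr (\<Sigma>\<^sub>o A) A' g" and h: "arr (\<Sigma>\<^sub>o B) B' h"
  shows "f' \<cdot> g \<^bold>+ h \<cdot> \<Sigma> f \<in> Delta_sub T A B A' B' f f'"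
proof -
  note S = arr_Shift[OF f]
  have "h \<cdot> \<Sigma> f = Neg T (\<Sigma>\<^sub>o A) B' (Neg T (\<Sigma>\<^sub>o B) B' h \<cdot> \<Sigma> f)"
    using arr_Neg_Comp[OF S h] arr_Neg_Neg[OF arr_Comp[OF S h]] by simp
  moreover have "g \<in> Hom T (\<Sigma>\<^sub>o A) A'" "Neg T (\<Sigma>\<^sub>o B) B' h \<in> Hom T (\<Sigma>\<^sub>o B) B'"
    using g arr_Neg[OF h] by (simp_all add: arr_def)
  ultimately show ?thesis
    unfolding Delta_sub_def by (intro CollectI exI conjI) simp_all
qed

text \<open>The two summands of \<open>d\<close> die for different reasons: \<open>g' f' = 0\<close>
  on the left and \<open>\<Sigma> f \<cdot> h = 0\<close> on the right.\<close>

lemma theta_vanish: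
  assumes D: "Dist T A B Z f g h" and D': "Dist T A' B' Z' f' g' h'"
    and d: "d \<in> Delta_sub T A B A' B' f f'"
  shows "arr (\<Sigma>\<^sub>o A) B' d" "g' \<cdot> d \<cdot> h = Zero T Z Z'"
proof -
  note a = Dist_arr[OF D] and a' = Dist_arr[OF D']
  note S = arr_Shift[OF a(1)]
  have o: "Z \<in> Ob T" "\<Sigma>\<^sub>o A \<in> Ob T" "\<Sigma>\<^sub>o B \<in> Ob T" "A' \<in> Ob T" "B' \<in> Ob T" "Z' \<in> Ob T"
    using a(3) a' S by (simp_all add: arr_def)
  obtain x y where x: "arr (\<Sigma>\<^sub>o A) A' x" and y: "arr (\<Sigma>\<^sub>o B) B' y"
    and d: "d = f' \<cdot> x \<^bold>+ Neg T (\<Sigma>\<^sub>o A) B' (y \<cdot> \<Sigma> f)"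
    using d o by (auto simp: Delta_sub_def arr_def)
  note fx = arr_Comp[OF x a'(1)] and yS = arr_Comp[OF S y]
  note n = arr_Neg[OF yS]
  note gn = arr_Comp[OF n a'(2)]
  show "arr (\<Sigma>\<^sub>o A) B' d" unfolding d using arr_Add[OF fx n] .
  have "g' \<cdot> (f' \<cdot> x) = Zero T (\<Sigma>\<^sub>o A) Z'"
    using arr_assoc[OF x a'(1,2)] Dist_comp_Zero[OF D'] arr_Zero_Comp[OF x o(6)] by simp
  then have 1: "g' \<cdot> d = g' \<cdot> Neg T (\<Sigma>\<^sub>o A) B' (y \<cdot> \<Sigma> f)"
    unfolding d using arr_Comp_Add[OF fx n a'(2)] arr_Zero_Add[OF gn] by simp
  have "y \<cdot> \<Sigma> f \<cdot> h = Zero T Z B'"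
    using arr_assoc[OF a(3) S y] Dist_Shift_comp_Zero[OF D] arr_Comp_Zero[OF y o(1)] by simp
  then have "Neg T (\<Sigma>\<^sub>o A) B' (y \<cdot> \<Sigma> f) \<cdot> h = Zero T Z B'"
    using arr_Neg_Comp[OF a(3) yS] Neg_Zero[OF o(1,5)] by simp
  then show "g' \<cdot> d \<cdot> h = Zero T Z Z'"
    using 1 arr_assoc[OF a(3) n a'(2)] arr_Comp_Zero[OF a'(2) o(1)] by simp
qed

text \<open>The converse of \<open>theta_vanish\<close>, where splittability enters: a decomposed
  identity on one side of \<open>x\<close> writes \<open>x\<close> as a part through
  \<open>f'\<close> plus a part through \<open>\<Sigma> f\<close>.\<close>

lemma theta_kernel:
  assumes D: "Dist T A B Z f g h" and D': "Dist T A' B' Z' f' g' h'"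
    and sp: "splittable T A B f \<or> splittable T A' B' f'"
    and x: "arr (\<Sigma>\<^sub>o A) B' x" and gxh: "g' \<cdot> x \<cdot> h = Zero T Z Z'"
  shows "x \<in> Delta_sub T A B A' B' f f'"
proof -
  note a = Dist_arr[OF D] and a' = Dist_arr[OF D']
  note S = arr_Shift[OF a(1)]
  note xh = arr_Comp[OF a(3) x] and gx = arr_Comp[OF x a'(2)]
  show ?thesis
    using sp
  proof
    assume "splittable T A B f"
    then obtain s t where s: "arr (\<Sigma>\<^sub>o B) (\<Sigma>\<^sub>o A) s" and t: "arr (\<Sigma>\<^sub>o A) Z t"
      and st: "s \<cdot> \<Sigma> f \<^bold>+ h \<cdot> t = Id T (\<Sigma>\<^sub>o A)"
      by (rule splittable_split_right[OF D])
    have "g' \<cdot> (x \<cdot> h) = Zero T Z Z'" using arr_assoc[OF a(3) x a'(2)] gxh by simp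
    then obtain k where k: "arr Z A' k" "f' \<cdot> k = x \<cdot> h" by (rule Dist_lift[OF D' xh])
    note kt = arr_Comp[OF t k(1)] and xs = arr_Comp[OF s x]
    \<comment> \<open>The first summand already passes through \<open>\<Sigma> f\<close>; the second
      passes through \<open>x h\<close>, which was lifted along \<open>f'\<close>.\<close>
    have "x = x \<cdot> (s \<cdot> \<Sigma> f \<^bold>+ h \<cdot> t)" using st arr_Comp_Id[OF x] by simp
    also have "\<dots> = x \<cdot> s \<cdot> \<Sigma> f \<^bold>+ x \<cdot> h \<cdot> t"
      using arr_Comp_Add[OF arr_Comp[OF S s] arr_Comp[OF t a(3)] x] arr_assoc[OF S s x]
        arr_assoc[OF t a(3) x] by simp
    also have "x \<cdot> h \<cdot> t = f' \<cdot> (k \<cdot> t)" using k(2) arr_assoc[OF t k(1) a'(1)] by simp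
    also have "x \<cdot> s \<cdot> \<Sigma> f \<^bold>+ f' \<cdot> (k \<cdot> t) = f' \<cdot> (k \<cdot> t) \<^bold>+ x \<cdot> s \<cdot> \<Sigma> f"
      using arr_Add_commute[OF arr_Comp[OF S xs] arr_Comp[OF kt a'(1)]] .
    finally have eq: "x = f' \<cdot> (k \<cdot> t) \<^bold>+ x \<cdot> s \<cdot> \<Sigma> f" .
    show ?thesis by (subst eq) (rule Delta_subI[OF a(1) a'(1) kt xs])
  next
    assume "splittable T A' B' f'"
    then obtain s t where s: "arr B' A' s" and t: "arr Z' B' t"
      and st: "f' \<cdot> s \<^bold>+ t \<cdot> g' = Id T B'"
      by (rule splittable_split_left[OF D'])
    obtain k where k: "arr (\<Sigma>\<^sub>o B) Z' k" "k \<cdot> \<Sigma> f = g' \<cdot> x"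
      using Dist_extend_Shift[OF D gx gxh] .
    note sx = arr_Comp[OF x s] and tk = arr_Comp[OF k(1) t]
    \<comment> \<open>Now the first summand already passes through \<open>f'\<close>, and the second
      passes through \<open>g' x\<close>, which was extended along
      \<open>\<Sigma> f\<close>.\<close>
    have "x = (f' \<cdot> s \<^bold>+ t \<cdot> g') \<cdot> x" using st arr_Id_Comp[OF x] by simp
    also have "\<dots> = f' \<cdot> (s \<cdot> x) \<^bold>+ t \<cdot> (g' \<cdot> x)"
      using arr_Add_Comp[OF x arr_Comp[OF s a'(1)] arr_Comp[OF a'(2) t]] arr_assoc[OF x s a'(1)]
        arr_assoc[OF x a'(2) t] by simp
    also have "t \<cdot> (g' \<cdot> x) = t \<cdot> k \<cdot> \<Sigma> f" using k(2) arr_assoc[OF S k(1) t] by simp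
    finally have eq: "x = f' \<cdot> (s \<cdot> x) \<^bold>+ t \<cdot> k \<cdot> \<Sigma> f" .
    show ?thesis by (subst eq) (rule Delta_subI[OF a(1) a'(1) sx tk])
  qed
qed

text \<open>The two conditions on \<open>c\<close> give one factorization each,
  \<open>c = y h\<close> and \<open>c = g' b\<close>. Both are used in either case: one supplies the
  preimage, the other checks it.\<close>

lemma theta_surj:
  assumes D: "Dist T A B Z f g h" and D': "Dist T A' B' Z' f' g' h'"
    and sp: "splittable T A B f \<or> splittable T A' B' f'"
    and c: "arr Z Z' c" and cg: "c \<cdot> g = Zero T B Z'" and hc: "h' \<cdot> c = Zero T Z (\<Sigma>\<^sub>o A')"
  obtains x where "arr (\<Sigma>\<^sub>o A) B' x" "g' \<cdot> x \<cdot> h = c"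
proof -
  note a = Dist_arr[OF D] and a' = Dist_arr[OF D']
  obtain y where y: "arr (\<Sigma>\<^sub>o A) Z' y" "y \<cdot> h = c" using Dist_extend[OF TR3[OF D] c cg] .
  obtain b where b: "arr Z B' b" "g' \<cdot> b = c" using Dist_lift[OF TR3[OF D'] c hc] .
  show thesis
    using sp
  proof
    assume "splittable T A B f"
    then obtain s t where t: "arr (\<Sigma>\<^sub>o A) Z t" and hth: "h \<cdot> (t \<cdot> h) = h"
      by (rule splittable_split_right[OF D])
    note bt = arr_Comp[OF t b(1)] and th = arr_Comp[OF a(3) t]
    \<comment> \<open>The preimage is \<open>b t\<close>; rewriting \<open>c\<close> as
      \<open>y h\<close> makes \<open>h t h = h\<close> applicable.\<close>
    have "g' \<cdot> (b \<cdot> t) \<cdot> h = c \<cdot> (t \<cdot> h)"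
      using arr_assoc[OF t b(1) a'(2)] arr_assoc[OF a(3) t c] b(2) by simp
    also have "\<dots> = y \<cdot> (h \<cdot> (t \<cdot> h))" using arr_assoc[OF th a(3) y(1)] y(2) by simp
    also have "\<dots> = c" using hth y(2) by simp
    finally show thesis using that bt by blast
  next
    assume "splittable T A' B' f'"
    then obtain s t where t: "arr Z' B' t" and gtg: "g' \<cdot> (t \<cdot> g') = g'"
      by (rule splittable_split_left[OF D'])
    note ty = arr_Comp[OF y(1) t] and tg = arr_Comp[OF a'(2) t]
    \<comment> \<open>The preimage is \<open>t y\<close>; rewriting \<open>c\<close> as
      \<open>g' b\<close> makes \<open>g' t g' = g'\<close> applicable.\<close>
    have "g' \<cdot> (t \<cdot> y) \<cdot> h = g' \<cdot> (t \<cdot> c)"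
      using arr_assoc[OF a(3) ty a'(2)] arr_assoc[OF a(3) y(1) t] y(2) by simp
    also have "\<dots> = g' \<cdot> (t \<cdot> g') \<cdot> b"
      using arr_assoc[OF b(1) tg a'(2)] arr_assoc[OF b(1) a'(2) t] b(2) by simp
    also have "\<dots> = c" using gtg b(2) by simp
    finally show thesis using that ty by blast
  qed
qed

text \<open>The carrier is the intersection of the kernels of two additive maps, composition with
  \<open>u f\<close> and with \<open>v f'\<close>, hence a subgroup of the hom-group.\<close>

lemma Theta_group:
  assumes g: "arr B (cone f) (u f)" and h': "arr (cone f') (\<Sigma>\<^sub>o A') (v f')"
  shows "group (Theta T cone u v A B A' B' f f')"
proof -
  let ?Z = "cone f" and ?Z' = "cone f'"
  have o: "B \<in> Ob T" "?Z \<in> Ob T" "?Z' \<in> Ob T" "\<Sigma>\<^sub>o A' \<in> Ob T"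
    using g h' by (simp_all add: arr_def)
  interpret G: group "hom_group T ?Z ?Z'" using hom_group[OF o(2,3)] .
  note z = Zero_in_Hom[OF o(2,3)]
  have zz: "Zero T X Y \<^bold>+ Zero T X Y = Zero T X Y" if "X \<in> Ob T" "Y \<in> Ob T" for X Y
    using arr_Zero_Add[OF arr_Zero[OF that]] .
  have "subgroup {c \<in> Hom T ?Z ?Z'. c \<cdot> u f = Zero T B ?Z' \<and> v f' \<cdot> c = Zero T ?Z (\<Sigma>\<^sub>o A')}
    (hom_group T ?Z ?Z')" (is "subgroup ?S _")
  proof (rule G.subgroupI)
    show "?S \<noteq> {}"
      using z arr_Zero_Comp[OF g o(3)] arr_Comp_Zero[OF h' o(2)] by auto
  next
    fix c assume "c \<in> ?S"
    then have "arr ?Z ?Z' c" "c \<cdot> u f = Zero T B ?Z'" "v f' \<cdot> c = Zero T ?Z (\<Sigma>\<^sub>o A')"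
      using o by (auto simp: arr_def)
    then show "Neg T ?Z ?Z' c \<in> ?S"
      using arr_Neg[of ?Z ?Z' c] arr_Neg_Comp[OF g, of ?Z' c] arr_Comp_Neg[OF _ h', of ?Z c]
        Neg_Zero[OF o(1,3)] Neg_Zero[OF o(2,4)] by (simp add: arr_def)
  next
    fix c d assume "c \<in> ?S" "d \<in> ?S"
    then have "arr ?Z ?Z' c" "c \<cdot> u f = Zero T B ?Z'" "v f' \<cdot> c = Zero T ?Z (\<Sigma>\<^sub>o A')"
      "arr ?Z ?Z' d" "d \<cdot> u f = Zero T B ?Z'" "v f' \<cdot> d = Zero T ?Z (\<Sigma>\<^sub>o A')"
      using o by (auto simp: arr_def)
    then show "c \<otimes>\<^bsub>hom_group T ?Z ?Z'\<^esub> d \<in> ?S"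
      using arr_Add[of ?Z ?Z' c d] arr_Add_Comp[OF g, of ?Z' c d] arr_Comp_Add[OF _ _ h', of ?Z c d]
        zz[OF o(1,3)] zz[OF o(2,4)] by (simp add: arr_def)
  qed auto
  then show ?thesis unfolding Theta_def by (rule G.subgroup_imp_group)
qed

end

theorem proposition3p7p1:
  fixes T :: "('o, 'm, 'x) triangulated_category_scheme"
    and cone :: "'m \<Rightarrow> 'o" and u v :: "'m \<Rightarrow> 'm"
    and A B A' B' :: 'o and f f' :: 'm
  assumes "puppe_triangulated T"
    and "chosen_triangles T cone u v"
    and "A \<in> Ob T" and "B \<in> Ob T" and "f \<in> Hom T A B"
    and "A' \<in> Ob T" and "B' \<in> Ob T" and "f' \<in> Hom T A' B'"
    and "splittable T A B f \<or> splittable T A' B' f'"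
  shows "theta T u v f f' \<in>
    iso (Delta T A B A' B' f f') (Theta T cone u v A B A' B' f f')"
proof -
  interpret puppe_triangulated T by fact
  have D: "Dist T A B (cone f) f (u f) (v f)" and D': "Dist T A' B' (cone f') f' (u f') (v f')"
    using assms(2-8) by (simp_all add: chosen_triangles_def)
  note a = Dist_arr[OF D] and a' = Dist_arr[OF D']
  define G where "G = hom_group T (\<Sigma>\<^sub>o\<^bsub>T\<^esub> A) B'"
  define H where "H = Theta T cone u v A B A' B' f f'"
  define \<phi> where "\<phi> = (\<lambda>x. u f' \<cdot>\<^bsub>T\<^esub> x \<cdot>\<^bsub>T\<^esub> v f)"
  have o: "cone f \<in> Ob T" "cone f' \<in> Ob T" "\<Sigma>\<^sub>o\<^bsub>T\<^esub> A \<in> Ob T" "\<Sigma>\<^sub>o\<^bsub>T\<^esub> A' \<in> Ob T"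
    using a a' by (simp_all add: arr_def)
  have carrier_G: "x \<in> carrier G \<longleftrightarrow> arr (\<Sigma>\<^sub>o\<^bsub>T\<^esub> A) B' x" for x
    using o assms(7) by (simp add: G_def arr_def)
  have carrier_H: "c \<in> carrier H \<longleftrightarrow> arr (cone f) (cone f') c \<and>
      c \<cdot>\<^bsub>T\<^esub> u f = Zero T B (cone f') \<and> v f' \<cdot>\<^bsub>T\<^esub> c = Zero T (cone f) (\<Sigma>\<^sub>o\<^bsub>T\<^esub> A')" for c
    using o by (simp add: H_def Theta_def arr_def)
  have one_H: "\<one>\<^bsub>H\<^esub> = Zero T (cone f) (cone f')" by (simp add: H_def Theta_def)
  have \<phi>_carrier: "\<phi> x \<in> carrier H" if "arr (\<Sigma>\<^sub>o\<^bsub>T\<^esub> A) B' x" for x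
  proof -
    note gx = arr_Comp[OF that a'(2)] and xh = arr_Comp[OF a(3) that]
    \<comment> \<open>Membership in \<open>Theta\<close> comes from \<open>v u = 0\<close> in both
      chosen triangles, which is the vanishing of consecutive maps after one rotation.\<close>
    have "v f' \<cdot>\<^bsub>T\<^esub> (u f' \<cdot>\<^bsub>T\<^esub> (x \<cdot>\<^bsub>T\<^esub> v f)) = Zero T (cone f) (\<Sigma>\<^sub>o\<^bsub>T\<^esub> A')"
      using arr_assoc[OF xh a'(2,3)] Dist_comp_Zero[OF TR3[OF D']] arr_Zero_Comp[OF xh o(4)]
      by simp
    moreover have "u f' \<cdot>\<^bsub>T\<^esub> x \<cdot>\<^bsub>T\<^esub> v f \<cdot>\<^bsub>T\<^esub> u f = Zero T B (cone f')"
      using arr_assoc[OF a(2,3) gx] Dist_comp_Zero[OF TR3[OF D]] arr_Comp_Zero[OF gx assms(4)]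
      by simp
    ultimately show ?thesis
      unfolding carrier_H \<phi>_def using arr_Comp[OF a(3) gx] arr_assoc[OF a(3) that a'(2)] by simp
  qed
  have "group_hom G H \<phi>"
  proof (intro group_hom.intro group_hom_axioms.intro homI)
    show "group G" unfolding G_def using hom_group[OF o(3) assms(7)] .
    show "group H" unfolding H_def by (rule Theta_group) (fact a(2) a'(3))+
    fix x y assume "x \<in> carrier G" "y \<in> carrier G"
    then have xy: "arr (\<Sigma>\<^sub>o\<^bsub>T\<^esub> A) B' x" "arr (\<Sigma>\<^sub>o\<^bsub>T\<^esub> A) B' y" by (simp_all add: carrier_G)
    show "\<phi> (x \<otimes>\<^bsub>G\<^esub> y) = \<phi> x \<otimes>\<^bsub>H\<^esub> \<phi> y"
      using arr_Comp_Add[OF xy a'(2)]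
        arr_Add_Comp[OF a(3) arr_Comp[OF xy(1) a'(2)] arr_Comp[OF xy(2) a'(2)]]
      by (simp add: \<phi>_def G_def H_def Theta_def)
  qed (simp add: carrier_G \<phi>_carrier)
  moreover have "\<phi> ` carrier G = carrier H"
  proof
    show "\<phi> ` carrier G \<subseteq> carrier H" using \<phi>_carrier by (auto simp: carrier_G)
    show "carrier H \<subseteq> \<phi> ` carrier G"
    proof
      fix c assume "c \<in> carrier H"
      then obtain x where "arr (\<Sigma>\<^sub>o\<^bsub>T\<^esub> A) B' x" "\<phi> x = c"
        unfolding carrier_H \<phi>_def using theta_surj[OF D D' assms(9)] by blast
      then show "c \<in> \<phi> ` carrier G" by (auto simp: carrier_G)
    qed
  qed
  \<comment> \<open>Being a kernel, \<open>Delta_sub\<close> is a normal subgroup, so the quotient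
    \<open>Delta\<close> is a group.\<close>
  moreover have "kernel G H \<phi> = Delta_sub T A B A' B' f f'"
    using theta_vanish[OF D D'] theta_kernel[OF D D' assms(9)]
    by (auto simp: kernel_def carrier_G one_H \<phi>_def)
  \<comment> \<open>The first isomorphism theorem; its map on cosets has the same
    \<open>the_elem\<close> form as \<open>theta\<close>.\<close>
  ultimately have "(\<lambda>X. the_elem (\<phi> ` X)) \<in> iso (G Mod Delta_sub T A B A' B' f f') H"
    using group_hom.FactGroup_iso_set by fastforce
  moreover have "theta T u v f f' = (\<lambda>X. the_elem (\<phi> ` X))"
    by (simp add: theta_def \<phi>_def fun_eq_iff)
  ultimately show ?thesis by (simp add: Delta_def G_def H_def)
qed

end
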